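(* Any two neighbouring discrete curvature lines of a discrete isothermic surface form a Darboux pair of discrete polarised curves. That is, if $f:(\Sigma^2,\frac1\mu)\to\mathbb{H}$ is a discrete isothermic surface on a discrete rectangular domain $\Sigma^2=\Sigma^1\times\tilde\Sigma^1$, then for all $n_0,n_0+1\in\tilde\Sigma^1$ the discrete curves $m\mapsto f_{m,n_0}$ and $m\mapsto f_{m,n_0+1}$, polarised by the restriction of $\frac1\mu$ to the edges in the $m$-direction, form a Darboux pair (for some spectral parameter), and likewise for all $m_0,m_0+1\in\Sigma^1$ the discrete curves $n\mapsto f_{m_0,n}$ and $n\mapsto f_{m_0+1,n}$, polarised by the restriction of $\frac1\mu$ to the edges in the $n$-direction, form a Darboux pair.
   Context: $\mathbb{H}$ denotes the quaternions; $\Sigma^1,\tilde\Sigma^1\subset\mathbb{Z}$ are simply connected (intervals of consecutive integers). An elementary quadrilateral $(ijk\ell)$ has vertices $i=(m,n)$, $j=(m+1,n)$, $k=(m+1,n+1)$, $\ell=(m,n+1)$; $f_i=f(i)$. The cross-ratio is $$\mathrm{cr}(a,b,c,d)=(a-b)(b-c)^{-1}(c-d)(d-a)^{-1}.$$ A discrete surface $f:\Sigma^2\to\mathbb{H}$ is discrete isothermic if on every elementary quadrilateral $\mathrm{cr}(f_i,f_j,f_k,f_\ell)=\mu_{i\ell}/\mu_{ij}$ for some nowhere-zero real function $\mu$ on unoriented edges with $\mu_{ij}=\mu_{k\ell}$ and $\mu_{i\ell}=\mu_{jk}$ (edge-labelling property); one writes $f:(\Sigma^2,\frac1\mu)\to\mathbb{H}$.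 By the edge-labelling property, all $m$-curvature lines $m\mapsto f_{m,n_0}$ carry the same restricted function $\mu$, and similarly for all $n$-curvature lines. A discrete polarised curve is a map $g:(\Sigma^1,\frac1\mu)\to\mathbb{H}$ where $\mu$ is a nowhere vanishing real function on the unoriented edges of an interval $\Sigma^1\subset\mathbb{Z}$. Two discrete polarised curves $g,\hat g:(\Sigma^1,\frac1\mu)\to\mathbb{H}$ form a Darboux pair with (real) spectral parameter $\nu$ if $\mathrm{cr}(g_i,g_j,\hat g_j,\hat g_i)=\nu/\mu_{ij}$ on every edge $(ij)$. *)

theory Defs
  imports Complex_Main
begin

section \<open>The quaternions\<close>

datatype quat = Quat (qre: real) (qi: real) (qj: real) (qk: real)

lemma quat_eq_iff:
  "x = y \<longleftrightarrow> qre x = qre y \<and> qi x = qi y \<and> qj x = qj y \<and> qk x = qk y"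
  by (cases x; cases y) simp

instantiation quat :: ab_group_add
begin

definition "0 = Quat 0 0 0 0"
definition "x + y = Quat (qre x + qre y) (qi x + qi y) (qj x + qj y) (qk x + qk y)"
definition "- x = Quat (- qre x) (- qi x) (- qj x) (- qk x)"
definition "x - y = Quat (qre x - qre y) (qi x - qi y) (qj x - qj y) (qk x - qk y)"

instance
  by standard
    (simp_all add: quat_eq_iff zero_quat_def plus_quat_def uminus_quat_def minus_quat_def)

end

instantiation quat :: ring_1
begin

definition "1 = Quat 1 0 0 0"
definition "x * y = Quat
  (qre x * qre y - qi x * qi y - qj x * qj y - qk x * qk y)
  (qre x * qi y + qi x * qre y + qj x * qk y - qk x * qj y)
  (qre x * qj y - qi x * qk y + qj x * qre y + qk x * qi y)
  (qre x * qk y + qi x * qj y - qj x * qi y + qk x * qre y)"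

instance
  by standard
    (simp_all add: quat_eq_iff zero_quat_def one_quat_def plus_quat_def times_quat_def
      algebra_simps)

end

instantiation quat :: real_algebra_1
begin

definition "r *\<^sub>R x = Quat (r * qre x) (r * qi x) (r * qj x) (r * qk x)"

instance
  by standard
    (simp_all add: quat_eq_iff plus_quat_def times_quat_def scaleR_quat_def algebra_simps)

end

instantiation quat :: real_div_algebra
begin

text \<open>The conjugate divided by the squared norm; in particular \<open>inverse 0 = 0\<close>.\<close>

definition inverse_quat :: "quat \<Rightarrow> quat" where
  "inverse x = (1 / ((qre x)\<^sup>2 + (qi x)\<^sup>2 + (qj x)\<^sup>2 + (qk x)\<^sup>2)) *\<^sub>R
     Quat (qre x) (- qi x) (- qj x) (- qk x)"
definition "(x :: quat) div y = x * inverse y"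

instance
proof
  fix x y :: quat
  show "x div y = x * inverse y"
    by (rule divide_quat_def)
  show "inverse 0 = (0 :: quat)"
    by (simp add: inverse_quat_def zero_quat_def scaleR_quat_def)
  assume "x \<noteq> 0"
  define N where "N = (qre x)\<^sup>2 + (qi x)\<^sup>2 + (qj x)\<^sup>2 + (qk x)\<^sup>2"
  have "N \<noteq> 0"
    using \<open>x \<noteq> 0\<close> unfolding N_def
    by (simp add: quat_eq_iff zero_quat_def add_nonneg_eq_0_iff)
  define c where "c = Quat (qre x) (- qi x) (- qj x) (- qk x)"
  have inv: "inverse x = (1 / N) *\<^sub>R c"
    by (simp add: inverse_quat_def N_def c_def)
  have "c * x = N *\<^sub>R 1" "x * c = N *\<^sub>R 1"
    by (simp_all add: quat_eq_iff c_def N_def times_quat_def scaleR_quat_def one_quat_def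
        power2_eq_square algebra_simps)
  then show "inverse x * x = 1" "x * inverse x = 1"
    using \<open>N \<noteq> 0\<close> by (simp_all add: inv)
qed

end

section \<open>Discrete isothermic surfaces and Darboux pairs\<close>

definition cr :: "quat \<Rightarrow> quat \<Rightarrow> quat \<Rightarrow> quat \<Rightarrow> quat" where
  "cr a b c d = (a - b) * inverse (b - c) * (c - d) * inverse (d - a)"

definition int_interval :: "int set \<Rightarrow> bool" where
  "int_interval I \<longleftrightarrow> (\<forall>a\<in>I. \<forall>b\<in>I. {a..b} \<subseteq> I)"

text \<open>
  An unoriented edge is the set of its two end points, so a function on unoriented edges is
  a function on sets of vertices, of which only the values on edges of the domain matter.
  Polarisations are given by \<open>\<mu>\<close> rather than by \<open>1/\<mu>\<close>.

  The value of the cross-ratio required below is nonzero, so the convention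
  \<open>inverse 0 = 0\<close> cannot make a degenerate quadrilateral satisfy the condition.
\<close>

definition discrete_isothermic ::
  "int set \<Rightarrow> int set \<Rightarrow> ((int \<times> int) set \<Rightarrow> real) \<Rightarrow> (int \<times> int \<Rightarrow> quat) \<Rightarrow> bool" where
  "discrete_isothermic I J \<mu> f \<longleftrightarrow>
     int_interval I \<and> int_interval J \<and>
     (\<forall>m n. m \<in> I \<and> m + 1 \<in> I \<and> n \<in> J \<longrightarrow> \<mu> {(m, n), (m + 1, n)} \<noteq> 0) \<and>
     (\<forall>m n. m \<in> I \<and> n \<in> J \<and> n + 1 \<in> J \<longrightarrow> \<mu> {(m, n), (m, n + 1)} \<noteq> 0) \<and>
     (\<forall>m n. m \<in> I \<and> m + 1 \<in> I \<and> n \<in> J \<and> n + 1 \<in> J \<longrightarrow>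
        (let i = (m, n); j = (m + 1, n); k = (m + 1, n + 1); l = (m, n + 1) in
           \<mu> {i, j} = \<mu> {k, l} \<and> \<mu> {i, l} = \<mu> {j, k} \<and>
           cr (f i) (f j) (f k) (f l) = of_real (\<mu> {i, l} / \<mu> {i, j})))"

definition discrete_polarised_curve ::
  "int set \<Rightarrow> (int set \<Rightarrow> real) \<Rightarrow> (int \<Rightarrow> quat) \<Rightarrow> bool" where
  "discrete_polarised_curve I \<mu> g \<longleftrightarrow>
     int_interval I \<and> (\<forall>i. i \<in> I \<and> i + 1 \<in> I \<longrightarrow> \<mu> {i, i + 1} \<noteq> 0)"

text \<open>
  The curves \<open>g\<close> and \<open>g'\<close> come with their own edge functions \<open>\<mu>\<close> and \<open>\<mu>'\<close>, which have to
  agree on the edges of \<open>I\<close>. The cross-ratio condition is imposed for both orderings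
  \<open>(i, j)\<close> of the end points of an edge, and \<open>g i \<noteq> g' i\<close> (hence also \<open>g j \<noteq> g' j\<close>)
  ensures that the cross-ratio is defined.
\<close>

definition darboux_pair ::
  "int set \<Rightarrow> (int set \<Rightarrow> real) \<Rightarrow> (int \<Rightarrow> quat) \<Rightarrow> (int set \<Rightarrow> real) \<Rightarrow> (int \<Rightarrow> quat) \<Rightarrow> real \<Rightarrow> bool"
where
  "darboux_pair I \<mu> g \<mu>' g' \<nu> \<longleftrightarrow>
     discrete_polarised_curve I \<mu> g \<and> discrete_polarised_curve I \<mu>' g' \<and>
     (\<forall>i\<in>I. \<forall>j\<in>I. \<bar>i - j\<bar> = 1 \<longrightarrow>
        \<mu> {i, j} = \<mu>' {i, j} \<and> g i \<noteq> g' i \<and>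
        cr (g i) (g j) (g' j) (g' i) = of_real (\<nu> / \<mu> {i, j}))"

definition m_line :: "(int \<times> int \<Rightarrow> 'a) \<Rightarrow> int \<Rightarrow> int \<Rightarrow> 'a" where
  "m_line f n = (\<lambda>m. f (m, n))"

definition n_line :: "(int \<times> int \<Rightarrow> 'a) \<Rightarrow> int \<Rightarrow> int \<Rightarrow> 'a" where
  "n_line f m = (\<lambda>n. f (m, n))"

definition m_restrict :: "((int \<times> int) set \<Rightarrow> real) \<Rightarrow> int \<Rightarrow> int set \<Rightarrow> real" where
  "m_restrict \<mu> n = (\<lambda>e. \<mu> ((\<lambda>m. (m, n)) ` e))"

definition n_restrict :: "((int \<times> int) set \<Rightarrow> real) \<Rightarrow> int \<Rightarrow> int set \<Rightarrow> real" where
  "n_restrict \<mu> m = (\<lambda>e. \<mu> ((\<lambda>n. (m, n)) ` e))"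

end

theory Submission
  imports Defs
begin

text \<open>
  On the edge from \<open>(m, n)\<close> to \<open>(m + 1, n)\<close> the Darboux condition for two neighbouring
  \<open>m\<close>-curvature lines is the isothermic condition itself, with spectral parameter the value of
  \<open>\<mu>\<close> on the transversal edges, which is constant along the strip by the edge-labelling property.
  Traversing the edge backwards replaces \<open>cr a b c d\<close> by \<open>cr b a d c\<close>, and these agree when the
  cross-ratio is real. The statement for \<open>n\<close>-curvature lines follows by transposing the surface,
  which inverts the cross-ratio.
\<close>

text \<open>For nonzero \<open>a\<close>, the factor \<open>b\<close> is a real multiple of
  \<open>inverse a\<close>, because reals are central.\<close>

lemma commute_if_mult_real:
  fixes a b :: "'a::real_div_algebra"
  assumes "a * b = of_real c"
  shows "a * b = b * a"
proof (cases "a = 0")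
  case False
  have "b = inverse a * (a * b)"
    using False by (simp add: mult.assoc[symmetric])
  also have "\<dots> = of_real c * inverse a"
    by (simp add: assms of_real_def)
  finally have "b * a = of_real c"
    using False by (simp add: mult.assoc)
  then show ?thesis
    using assms by simp
qed simp

text \<open>Since \<open>inverse 0 = 0\<close>, a coincidence in any of the four differences makes
  the whole product vanish.\<close>

lemma cr_real_nonzero_distinct:
  assumes "cr a b c d = of_real r" "r \<noteq> 0"
  shows "a \<noteq> b" "b \<noteq> c" "c \<noteq> d" "d \<noteq> a"
  using assms unfolding cr_def by auto

text \<open>
  Write \<open>p, q, s, t\<close> for the four differences, so that \<open>p + q + s + t = 0\<close>. With
  \<open>A = p\<^sup>-\<^sup>1 q\<close> and \<open>B = s\<^sup>-\<^sup>1 q\<close>, the cross-ratio being \<open>r\<close> amounts to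
  \<open>(A + 1) (B + 1) = 1 - 1 / r\<close>; hence \<open>A\<close> and \<open>B\<close> commute, and reversing the quadrilateral
  exchanges \<open>A\<close> and \<open>B\<close>.
\<close>

lemma cr_real_reverse:
  assumes "cr a b c d = of_real r" "r \<noteq> 0"
  shows "cr b a d c = of_real r"
proof -
  define p q s t where pqst: "p = a - b" "q = b - c" "s = c - d" "t = d - a"
  note ne = cr_real_nonzero_distinct[OF assms]
  have nz: "p \<noteq> 0" "q \<noteq> 0" "s \<noteq> 0" "t \<noteq> 0"
    using ne by (auto simp: pqst)
  have t: "t = - (p + q + s)"
    by (simp add: pqst)
  define A B where AB: "A = inverse p * q" "B = inverse s * q"
  \<comment> \<open>Stated for general \<open>x\<close>, \<open>y\<close> because it is used for
    \<open>p\<close>, \<open>s\<close> and again for \<open>s\<close>, \<open>p\<close>.\<close>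
  have expand: "inverse x * t * inverse y * q = - (x' + y' + x' * y')"
    if "t = - (x + q + y)" "x \<noteq> 0" "y \<noteq> 0" "x' = inverse x * q" "y' = inverse y * q"
    for x y x' y'
  proof -
    have "inverse x * t = - (1 + x' + inverse x * y)"
      unfolding that(1,4) mult_minus_right distrib_left using that(2) by simp
    then have "inverse x * t * inverse y * q = - ((1 + x' + inverse x * y) * (inverse y * q))"
      by (simp only: mult.assoc[symmetric] mult_minus_left)
    also have "\<dots> = - (x' + y' + x' * y')"
    proof -
      have "y * (inverse y * q) = q"
        using that(3) by (simp flip: mult.assoc)
      then show ?thesis
        using that(4,5) by (simp add: distrib_right mult.assoc)
    qed
    finally show ?thesis .
  qed
  have "p * inverse q * s * inverse t = of_real r"
    using assms(1) by (simp add: cr_def pqst)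
  \<comment> \<open>The factors are rearranged until \<open>q\<close> stands at the right end, the
    shape to which \<open>expand\<close> applies.\<close>
  then have "p * inverse q * s = of_real r * t"
    using nz by (metis mult.assoc left_inverse mult_1_right)
  then have "inverse q * s = inverse p * (of_real r * t)"
    using nz by (metis mult.assoc left_inverse mult_1_left)
  then have "inverse q * s = of_real r * (inverse p * t)"
    by (simp add: of_real_def)
  then have "of_real r * (inverse p * t) * inverse s * q = 1"
    using nz by (metis mult.assoc left_inverse right_inverse mult_1_left)
  then have "of_real r * (inverse p * t * inverse s * q) = 1"
    by (simp only: mult.assoc)
  moreover have "inverse p * t * inverse s * q = - (A + B + A * B)"
    by (rule expand) (use t nz AB in auto)
  ultimately have rAB: "of_real r * - (A + B + A * B) = 1"
    by simp
  then have "- (A + B + A * B) = of_real (1 / r)"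
    using assms(2) by (metis inverse_unique of_real_inverse inverse_eq_divide)
  moreover have "(A + 1) * (B + 1) = 1 - - (A + B + A * B)"
    by (simp add: algebra_simps)
  ultimately have "(A + 1) * (B + 1) = of_real (1 - 1 / r)"
    by simp
  then have "(A + 1) * (B + 1) = (B + 1) * (A + 1)"
    by (rule commute_if_mult_real)
  then have "A * B = B * A"
    by (simp add: algebra_simps)
  then have "of_real r * - (B + A + B * A) = 1"
    using rAB by (simp add: add.commute)
  moreover have "inverse s * t * inverse p * q = - (B + A + B * A)"
    by (rule expand) (use t nz AB in \<open>auto simp: algebra_simps\<close>)
  ultimately have "of_real r * (inverse s * t * inverse p * q) = 1"
    by simp
  then have "inverse (inverse s * t * inverse p * q) = of_real r"
    by (metis inverse_unique inverse_inverse_eq inverse_zero mult_zero_right zero_neq_one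
        mult.assoc right_inverse mult_1_left mult_1_right)
  then have "inverse q * (p * (inverse t * s)) = of_real r"
    using nz by (simp add: nonzero_inverse_mult_distrib mult.assoc)
  \<comment> \<open>Moving \<open>inverse q\<close> from the left end to the right is conjugation by
    \<open>q\<close>, which fixes a real value.\<close>
  then have "p * (inverse t * s) = q * of_real r"
    using nz by (metis mult.assoc right_inverse mult_1_left)
  also have "\<dots> = of_real r * q"
    by (simp add: of_real_def)
  finally have "p * (inverse t * s) * inverse q = of_real r"
    using nz by (simp add: mult.assoc)
  moreover have "cr b a d c = p * inverse t * s * inverse q"
  proof -
    have "cr b a d c = (- p) * inverse (- t) * (- s) * inverse (- q)"
      by (simp add: cr_def pqst)
    then show ?thesis
      using nz by (simp add: nonzero_inverse_minus_eq)
  qed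
  ultimately show ?thesis
    by (simp add: mult.assoc)
qed

text \<open>Inversion reverses the order of the factors, and the four sign changes cancel. In the
  degenerate case both sides are 0.\<close>

lemma cr_transpose:
  "cr a d c b = inverse (cr a b c d)"
proof (cases "a = b \<or> b = c \<or> c = d \<or> d = a")
  case True
  then show ?thesis
    by (auto simp: cr_def)
next
  case False
  have "cr a d c b = (- (d - a)) * inverse (- (c - d)) * (- (b - c)) * inverse (- (a - b))"
    by (simp add: cr_def)
  also have "\<dots> = (d - a) * inverse (c - d) * (b - c) * inverse (a - b)"
    using False nonzero_inverse_minus_eq[of "c - d"] nonzero_inverse_minus_eq[of "a - b"]
    by (simp del: minus_diff_eq)
  also have "\<dots> = inverse (cr a b c d)"
    using False by (simp add: cr_def nonzero_inverse_mult_distrib mult.assoc)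
  finally show ?thesis .
qed

lemma int_interval_constant:
  assumes "int_interval I" "\<And>m. m \<in> I \<Longrightarrow> m + 1 \<in> I \<Longrightarrow> h m = h (m + 1)"
    and "a \<in> I" "b \<in> I"
  shows "h a = h b"
proof -
  have le: "h x = h y" if "x \<in> I" "x \<le> y" "y \<in> I" for x y
    using that(2,3)
  proof (induction y rule: int_ge_induct)
    case (step i)
    have "{x..i + 1} \<subseteq> I"
      using assms(1) that(1) step.prems by (auto simp: int_interval_def)
    then have "i \<in> I"
      using step.hyps by auto
    then show ?case
      using step assms(2) by metis
  qed simp
  show ?thesis
    using le[of a b] le[of b a] assms(3,4) by fastforce
qed

text \<open>The swap fixes the corners \<open>i\<close> and \<open>k\<close> and exchanges
  \<open>j\<close> and \<open>l\<close>, so the cross-ratio and the quotient of edge values are both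
  inverted.\<close>

lemma discrete_isothermic_transpose:
  assumes "discrete_isothermic I J \<mu> f"
  shows "discrete_isothermic J I (\<lambda>e. \<mu> (prod.swap ` e)) (f \<circ> prod.swap)"
proof -
  have "cr (f (n, m)) (f (n, m + 1)) (f (n + 1, m + 1)) (f (n + 1, m)) =
      of_real (\<mu> {(n, m), (n + 1, m)} / \<mu> {(n, m), (n, m + 1)})"
    if "n \<in> I" "n + 1 \<in> I" "m \<in> J" "m + 1 \<in> J" for m n
    using assms that cr_transpose[of "f (n, m)" "f (n, m + 1)" "f (n + 1, m + 1)" "f (n + 1, m)"]
    unfolding discrete_isothermic_def Let_def
    by (simp flip: of_real_inverse of_real_divide)
  then show ?thesis
    using assms unfolding discrete_isothermic_def Let_def
    by (auto simp: insert_commute simp del: of_real_divide)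
qed

lemma isothermic_m_lines_darboux:
  assumes iso: "discrete_isothermic I J \<mu> f" and n: "n \<in> J" "n + 1 \<in> J"
  shows "\<exists>\<nu>. darboux_pair I (m_restrict \<mu> n) (m_line f n)
                 (m_restrict \<mu> (n + 1)) (m_line f (n + 1)) \<nu>"
proof -
  have I: "int_interval I"
    using iso by (simp add: discrete_isothermic_def)
  have nz: "\<mu> {(m, n'), (m + 1, n')} \<noteq> 0" if "m \<in> I" "m + 1 \<in> I" "n' \<in> J" for m n'
    using iso that by (simp add: discrete_isothermic_def)
  have nz': "\<mu> {(m, n), (m, n + 1)} \<noteq> 0" if "m \<in> I" for m
    using iso that n by (simp add: discrete_isothermic_def)
  have quad: "\<mu> {(m, n), (m + 1, n)} = \<mu> {(m, n + 1), (m + 1, n + 1)}"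
    "\<mu> {(m, n), (m, n + 1)} = \<mu> {(m + 1, n), (m + 1, n + 1)}"
    "cr (f (m, n)) (f (m + 1, n)) (f (m + 1, n + 1)) (f (m, n + 1)) =
       of_real (\<mu> {(m, n), (m, n + 1)} / \<mu> {(m, n), (m + 1, n)})"
    if "m \<in> I" "m + 1 \<in> I" for m
    using iso that n by (auto simp: discrete_isothermic_def Let_def insert_commute)
  \<comment> \<open>The spectral parameter is the common value on the transversal edges; for empty
    \<open>I\<close> any real serves.\<close>
  obtain \<nu> where \<nu>: "\<And>m. m \<in> I \<Longrightarrow> \<mu> {(m, n), (m, n + 1)} = \<nu>"
    using int_interval_constant[of I "\<lambda>m. \<mu> {(m, n), (m, n + 1)}"] I quad(2) by metis
  have edge: "\<mu> {(m, n), (m + 1, n)} = \<mu> {(m, n + 1), (m + 1, n + 1)} \<and>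
      f (m, n) \<noteq> f (m, n + 1) \<and> f (m + 1, n) \<noteq> f (m + 1, n + 1) \<and>
      cr (f (m, n)) (f (m + 1, n)) (f (m + 1, n + 1)) (f (m, n + 1)) =
        of_real (\<nu> / \<mu> {(m, n), (m + 1, n)}) \<and>
      cr (f (m + 1, n)) (f (m, n)) (f (m, n + 1)) (f (m + 1, n + 1)) =
        of_real (\<nu> / \<mu> {(m, n), (m + 1, n)})"
    if "m \<in> I" "m + 1 \<in> I" for m
  proof -
    \<comment> \<open>A nonzero value gives both the reversed cross-ratio and the distinctness of
      corresponding points.\<close>
    have r: "\<nu> / \<mu> {(m, n), (m + 1, n)} \<noteq> 0"
      using nz[of m n] nz'[of m] \<nu>[of m] that n by simp
    have "cr (f (m, n)) (f (m + 1, n)) (f (m + 1, n + 1)) (f (m, n + 1)) =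
        of_real (\<nu> / \<mu> {(m, n), (m + 1, n)})"
      using quad(3) \<nu> that by metis
    from this cr_real_reverse[OF this r] cr_real_nonzero_distinct[OF this r] show ?thesis
      using quad(1)[OF that] by auto
  qed
  have "darboux_pair I (m_restrict \<mu> n) (m_line f n)
      (m_restrict \<mu> (n + 1)) (m_line f (n + 1)) \<nu>"
    unfolding darboux_pair_def discrete_polarised_curve_def
  proof (intro conjI allI impI ballI I)
    fix i j assume ij: "i \<in> I" "j \<in> I" "\<bar>i - j\<bar> = 1"
    then consider "j = i + 1" | "i = j + 1"
      by linarith
    then have "m_restrict \<mu> n {i, j} = m_restrict \<mu> (n + 1) {i, j} \<and>
        m_line f n i \<noteq> m_line f (n + 1) i \<and>
        cr (m_line f n i) (m_line f n j) (m_line f (n + 1) j) (m_line f (n + 1) i) =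
          of_real (\<nu> / m_restrict \<mu> n {i, j})"
    proof cases
      case 1
      then show ?thesis
        using edge[of i] ij by (simp add: m_restrict_def m_line_def)
    next
      case 2
      then show ?thesis
        using edge[of j] ij by (simp add: m_restrict_def m_line_def insert_commute)
    qed
    then show "m_restrict \<mu> n {i, j} = m_restrict \<mu> (n + 1) {i, j}"
      "m_line f n i \<noteq> m_line f (n + 1) i"
      "cr (m_line f n i) (m_line f n j) (m_line f (n + 1) j) (m_line f (n + 1) i) =
          of_real (\<nu> / m_restrict \<mu> n {i, j})"
      by blast+
  qed (use nz n in \<open>auto simp: m_restrict_def\<close>)
  then show ?thesis ..
qed

theorem proposition3p1:
  fixes I J :: "int set" and \<mu> :: "(int \<times> int) set \<Rightarrow> real" and f :: "int \<times> int \<Rightarrow> quat"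
  assumes "discrete_isothermic I J \<mu> f"
  shows "(\<forall>n0. n0 \<in> J \<and> n0 + 1 \<in> J \<longrightarrow>
            (\<exists>\<nu>. darboux_pair I (m_restrict \<mu> n0) (m_line f n0)
                               (m_restrict \<mu> (n0 + 1)) (m_line f (n0 + 1)) \<nu>)) \<and>
         (\<forall>m0. m0 \<in> I \<and> m0 + 1 \<in> I \<longrightarrow>
            (\<exists>\<nu>. darboux_pair J (n_restrict \<mu> m0) (n_line f m0)
                               (n_restrict \<mu> (m0 + 1)) (n_line f (m0 + 1)) \<nu>))"
proof (intro conjI allI impI)
  fix n0 assume "n0 \<in> J \<and> n0 + 1 \<in> J"
  then show "\<exists>\<nu>. darboux_pair I (m_restrict \<mu> n0) (m_line f n0)
      (m_restrict \<mu> (n0 + 1)) (m_line f (n0 + 1)) \<nu>"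
    using isothermic_m_lines_darboux[OF assms] by blast
next
  fix m0 assume "m0 \<in> I \<and> m0 + 1 \<in> I"
  \<comment> \<open>These identities carry the result for the transposed surface back to
    \<open>f\<close>.\<close>
  moreover have "m_restrict (\<lambda>e. \<mu> (prod.swap ` e)) m = n_restrict \<mu> m"
    "m_line (f \<circ> prod.swap) m = n_line f m" for m
    by (simp_all add: m_restrict_def n_restrict_def m_line_def n_line_def image_image)
  ultimately show "\<exists>\<nu>. darboux_pair J (n_restrict \<mu> m0) (n_line f m0)
      (n_restrict \<mu> (m0 + 1)) (n_line f (m0 + 1)) \<nu>"
    using isothermic_m_lines_darboux[OF discrete_isothermic_transpose[OF assms], of m0] by simp
qed

end
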